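(* Let $n\ge 1$ be an integer, let $A,B\in M_n(\mathbb{R})$ and let $\mathcal{M}=A+B\epsilon\in M_n(\mathbb{D})$. Then $\mathcal{M}$ is strongly nil-clean in $M_n(\mathbb{D})$ if and only if $A$ is strongly nil-clean in $M_n(\mathbb{R})$.
   Context: $\mathbb{D}=\{a+b\epsilon \mid a,b\in\mathbb{R},\ \epsilon^2=0\}$ is the ring of dual numbers. $M_n(\mathbb{D})$ is the ring of $n\times n$ matrices over $\mathbb{D}$; each element is uniquely of the form $A+B\epsilon$ with $A,B\in M_n(\mathbb{R})$. An element $a$ of a ring $R$ (associative with identity) is strongly nil-clean if $a=e+t$ where $e\in R$ is idempotent, $t\in R$ is nilpotent, and $et=te$. *)

theory Defs
  imports Complex_Main "Jordan_Normal_Form.Matrix"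
begin

datatype dual_number = Dual (std_part: real) (inf_part: real)

(* Dual a b stands for a + b * eps; the product rule encodes eps^2 = 0. *)

instantiation dual_number :: "{comm_ring_1, real_algebra_1}"
begin

definition zero_dual_number :: dual_number where
  "0 = Dual 0 0"

definition one_dual_number :: dual_number where
  "1 = Dual 1 0"

definition plus_dual_number :: "dual_number \<Rightarrow> dual_number \<Rightarrow> dual_number" where
  "x + y = Dual (std_part x + std_part y) (inf_part x + inf_part y)"

definition uminus_dual_number :: "dual_number \<Rightarrow> dual_number" where
  "- x = Dual (- std_part x) (- inf_part x)"

definition minus_dual_number :: "dual_number \<Rightarrow> dual_number \<Rightarrow> dual_number" where
  "x - y = Dual (std_part x - std_part y) (inf_part x - inf_part y)"

definition times_dual_number :: "dual_number \<Rightarrow> dual_number \<Rightarrow> dual_number" where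
  "x * y = Dual (std_part x * std_part y)
                (std_part x * inf_part y + inf_part x * std_part y)"

definition scaleR_dual_number :: "real \<Rightarrow> dual_number \<Rightarrow> dual_number" where
  "c *\<^sub>R x = Dual (c * std_part x) (c * inf_part x)"

instance
  by standard
    (auto simp: zero_dual_number_def one_dual_number_def plus_dual_number_def
      uminus_dual_number_def minus_dual_number_def times_dual_number_def
      scaleR_dual_number_def algebra_simps)

end

definition dual_eps :: dual_number where
  "dual_eps = Dual 0 1"

lemma dual_eps_square: "dual_eps ^ 2 = 0"
  by (simp add: dual_eps_def power2_eq_square times_dual_number_def zero_dual_number_def)

lemma of_real_dual_number: "of_real a = Dual a 0"
  by (simp add: of_real_def scaleR_dual_number_def one_dual_number_def)

lemma Dual_eq: "Dual a b = of_real a + of_real b * dual_eps"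
  by (simp add: of_real_dual_number dual_eps_def plus_dual_number_def times_dual_number_def)

definition dual_mat :: "real mat \<Rightarrow> real mat \<Rightarrow> dual_number mat" where
  "dual_mat A B = map_mat of_real A + dual_eps \<cdot>\<^sub>m map_mat of_real B"

lemma dual_mat_decomposition:
  assumes "M \<in> carrier_mat n n"
  shows "\<exists>!(A, B). A \<in> carrier_mat n n \<and> B \<in> carrier_mat n n \<and> M = dual_mat A B"
proof -
  have entry: "dual_mat A B $$ (i, j) = Dual (A $$ (i, j)) (B $$ (i, j))"
    if "A \<in> carrier_mat n n" "B \<in> carrier_mat n n" "i < n" "j < n" for A B i j
    using that by (simp add: dual_mat_def Dual_eq mult.commute)
  show ?thesis
  proof (rule ex1I[of _ "(map_mat std_part M, map_mat inf_part M)"])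
    show "case (map_mat std_part M, map_mat inf_part M) of (A, B) \<Rightarrow>
        A \<in> carrier_mat n n \<and> B \<in> carrier_mat n n \<and> M = dual_mat A B"
      using assms entry[of "map_mat std_part M" "map_mat inf_part M"]
      by (auto intro!: eq_matI simp: dual_mat_def)
  next
    fix p
    assume "case p of (A, B) \<Rightarrow>
        A \<in> carrier_mat n n \<and> B \<in> carrier_mat n n \<and> M = dual_mat A B"
    then show "p = (map_mat std_part M, map_mat inf_part M)"
      by (cases p) (auto intro!: eq_matI simp: dual_mat_def of_real_dual_number dual_eps_def
          plus_dual_number_def times_dual_number_def)
  qed
qed

definition ring_idempotent :: "('a, 'b) ring_scheme \<Rightarrow> 'a \<Rightarrow> bool" where
  "ring_idempotent R e \<longleftrightarrow> e \<in> carrier R \<and> e \<otimes>\<^bsub>R\<^esub> e = e"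

definition ring_nilpotent :: "('a, 'b) ring_scheme \<Rightarrow> 'a \<Rightarrow> bool" where
  "ring_nilpotent R t \<longleftrightarrow> t \<in> carrier R \<and> (\<exists>k::nat. k \<ge> 1 \<and> t [^]\<^bsub>R\<^esub> k = \<zero>\<^bsub>R\<^esub>)"

definition strongly_nil_clean :: "('a, 'b) ring_scheme \<Rightarrow> 'a \<Rightarrow> bool" where
  "strongly_nil_clean R a \<longleftrightarrow>
    (\<exists>e t. ring_idempotent R e \<and> ring_nilpotent R t \<and>
      a = e \<oplus>\<^bsub>R\<^esub> t \<and> e \<otimes>\<^bsub>R\<^esub> t = t \<otimes>\<^bsub>R\<^esub> e)"

end

theory Submission
  imports Defs "HOL-Algebra.Subrings"
begin

text \<open>In any ring, \<open>a\<close> is strongly nil-clean iff \<open>p = a - a\<^sup>2\<close> is nilpotent: if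
  \<open>a = e + t\<close> then \<open>p = t(1 - 2e - t)\<close>, and conversely an idempotent \<open>e\<close> with
  \<open>a - e\<close> a multiple of \<open>p\<close> is obtained by iteratively squaring \<open>p\<close>. All elements involved lie in
  the bicommutant of \<open>{e, t}\<close> or \<open>{a}\<close>, which is a commutative ring. The criterion
  transfers along any ring homomorphism with nil kernel, such as taking the standard part, whose
  kernel \<open>M\<^sub>n(\<real>)\<epsilon>\<close> squares to zero.\<close>

section \<open>Bicommutants as commutative subrings\<close>

text \<open>The double centralizer stands in for the subring generated by \<open>S\<close>: closure
  under the ring operations is immediate, with no need to describe elements as polynomials in
  \<open>S\<close>.\<close>

definition bicommutant :: "('a, 'b) ring_scheme \<Rightarrow> 'a set \<Rightarrow> 'a set" where
  "bicommutant R S = {x \<in> carrier R. \<forall>y\<in>carrier R.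
     (\<forall>s\<in>S. y \<otimes>\<^bsub>R\<^esub> s = s \<otimes>\<^bsub>R\<^esub> y) \<longrightarrow> x \<otimes>\<^bsub>R\<^esub> y = y \<otimes>\<^bsub>R\<^esub> x}"

lemma subset_bicommutant: "S \<subseteq> carrier R \<Longrightarrow> S \<subseteq> bicommutant R S"
  by (auto simp: bicommutant_def)

context ring
begin

lemma subring_bicommutant: "subring (bicommutant R S) R"
proof (rule subringI)
  fix x assume "x \<in> bicommutant R S"
  then show "\<ominus> x \<in> bicommutant R S"
    by (simp add: bicommutant_def l_minus r_minus)
next
  fix x y assume xy: "x \<in> bicommutant R S" "y \<in> bicommutant R S"
  show "x \<oplus> y \<in> bicommutant R S"
    using xy by (simp add: bicommutant_def l_distr r_distr)
  have "(x \<otimes> y) \<otimes> z = z \<otimes> (x \<otimes> y)"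
    if "z \<in> carrier R" "\<forall>s\<in>S. z \<otimes> s = s \<otimes> z" for z
  proof -
    have c: "x \<in> carrier R" "y \<in> carrier R" "x \<otimes> z = z \<otimes> x" "y \<otimes> z = z \<otimes> y"
      using xy that by (auto simp: bicommutant_def)
    then show ?thesis
      using that(1) m_assoc[of x y z] m_assoc[of x z y] m_assoc[of z x y] by simp
  qed
  then show "x \<otimes> y \<in> bicommutant R S"
    using xy by (simp add: bicommutant_def)
qed (auto simp: bicommutant_def)

text \<open>Elements of a commuting \<open>S\<close> are themselves test elements \<open>y\<close>
  in the definition, so every member of the bicommutant commutes with \<open>S\<close>. It is then a
  test element too, and any other member commutes with it.\<close>

lemma cring_bicommutant:
  assumes S: "S \<subseteq> carrier R" and comm: "\<And>s t. s \<in> S \<Longrightarrow> t \<in> S \<Longrightarrow> s \<otimes> t = t \<otimes> s"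
  shows "cring (R \<lparr>carrier := bicommutant R S\<rparr>)"
proof -
  have "subcring (bicommutant R S) R"
  proof (rule subcringI[OF subring_bicommutant])
    fix x y assume x: "x \<in> bicommutant R S" and y: "y \<in> bicommutant R S"
    have "y \<otimes> s = s \<otimes> y" if "s \<in> S" for s
      using y S comm that by (auto simp: bicommutant_def)
    then show "x \<otimes> y = y \<otimes> x"
      using x y by (auto simp: bicommutant_def)
  qed
  then show ?thesis
    using subcring_iff[of "bicommutant R S"] by (auto simp: bicommutant_def)
qed

end

section \<open>Lifting idempotents in a commutative ring\<close>

lemma (in ring) eq_add_iff_eq_minus:
  assumes "a \<in> carrier R" "b \<in> carrier R" "c \<in> carrier R"
  shows "a = b \<oplus> c \<longleftrightarrow> c = a \<ominus> b"
  using assms by (metis a_comm add.inv_closed add.inv_solve_right' minus_eq)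

text \<open>Splitting \<open>1 = (a + c)\<^sup>3\<close> as \<open>b + d\<close> with \<open>b = a\<^sup>2(a + 3c)\<close> and
  \<open>d = c\<^sup>2(c + 3a)\<close> makes \<open>bd\<close> a multiple of \<open>(ac)\<^sup>2\<close>, and
  \<open>a - b = ac(c - a)\<close>.\<close>

lemma (in cring) lift_idempotent:
  assumes "a \<in> carrier R" "c \<in> carrier R" "a \<oplus> c = \<one>" "(a \<otimes> c) [^] Suc k = \<zero>"
  shows "\<exists>e\<in>carrier R. \<exists>r\<in>carrier R. e \<otimes> e = e \<and> a = e \<oplus> (a \<otimes> c) \<otimes> r"
  using assms
proof (induction k arbitrary: a c)
  case 0
  \<comment> \<open>The exponent is 1, so \<open>a \<otimes> c\<close> vanishes and \<open>a\<close>
    is already idempotent.\<close>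
  then have "a = a \<otimes> (a \<oplus> c)" "a \<otimes> c = \<zero>" by simp_all
  with 0 have "a \<otimes> a = a" by (metis r_distr r_zero m_closed)
  with 0 \<open>a \<otimes> c = \<zero>\<close> show ?case
    by (intro bexI[of _ a] bexI[of _ \<zero>]) auto
next
  case (Suc k)
  note [simp] = \<open>a \<in> carrier R\<close> \<open>c \<in> carrier R\<close>
  define p where "p = a \<otimes> c"
  define b where "b = a \<otimes> a \<otimes> (a \<oplus> c \<oplus> c \<oplus> c)"
  define d where "d = c \<otimes> c \<otimes> (c \<oplus> a \<oplus> a \<oplus> a)"
  define z where "z = (a \<oplus> c \<oplus> c \<oplus> c) \<otimes> (c \<oplus> a \<oplus> a \<oplus> a)"
  define s where "s = c \<ominus> a"
  have [simp]: "p \<in> carrier R" "b \<in> carrier R" "d \<in> carrier R" "z \<in> carrier R" "s \<in> carrier R"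
    by (simp_all add: p_def z_def b_def d_def s_def)
  have "b \<oplus> d = (a \<oplus> c) \<otimes> (a \<oplus> c) \<otimes> (a \<oplus> c)"
    unfolding b_def d_def by (simp add: l_distr r_distr m_ac a_ac)
  then have bd: "b \<oplus> d = \<one>"
    using Suc.prems(3) by simp
  have q: "b \<otimes> d = p \<otimes> p \<otimes> z"
    unfolding b_def d_def p_def z_def
    using m_comm[of c "a \<oplus> c \<oplus> c \<oplus> c"] by (simp add: m_ac)
  have "(b \<otimes> d) [^] Suc k = (p [^] Suc k \<otimes> p [^] Suc k) \<otimes> z [^] Suc k"
    unfolding q by (simp add: nat_pow_distrib m_ac)
  \<comment> \<open>Since 2(k + 1) = (k + 2) + k, the power of \<open>p\<close> known to vanish
    splits off.\<close>
  also have "p [^] Suc k \<otimes> p [^] Suc k = p [^] Suc (Suc k) \<otimes> p [^] k"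
    by (simp add: m_ac)
  finally have "(b \<otimes> d) [^] Suc k = \<zero>"
    using Suc.prems(4) by (simp add: p_def del: nat_pow_Suc)
  then obtain e r where e: "e \<in> carrier R" "r \<in> carrier R" "e \<otimes> e = e" "b = e \<oplus> b \<otimes> d \<otimes> r"
    using Suc.IH[of b d] bd by auto
  \<comment> \<open>Adding \<open>p \<otimes> s\<close> trades one of the three copies of
    \<open>p \<otimes> a\<close> in \<open>b\<close> for \<open>p \<otimes> c\<close>, which
    completes a(a + c)^2 = a.\<close>
  have "p \<otimes> a \<oplus> p \<otimes> s = p \<otimes> c"
    using r_distr[of a s p] eq_add_iff_eq_minus[of c a s] by (simp add: s_def)
  moreover have "b = a \<otimes> a \<otimes> a \<oplus> p \<otimes> a \<oplus> p \<otimes> a \<oplus> p \<otimes> a"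
    unfolding b_def p_def by (simp add: l_distr r_distr m_ac a_ac)
  ultimately have "b \<oplus> p \<otimes> s = a \<otimes> a \<otimes> a \<oplus> p \<otimes> a \<oplus> p \<otimes> a \<oplus> p \<otimes> c"
    by (simp add: a_assoc)
  also have "\<dots> = a \<otimes> (a \<oplus> c) \<otimes> (a \<oplus> c)"
    unfolding p_def by (simp add: l_distr r_distr m_ac a_ac)
  finally have "a = b \<oplus> p \<otimes> s"
    using Suc.prems(3) by simp
  \<comment> \<open>The error from the induction hypothesis is a multiple of
    \<open>b \<otimes> d\<close>, hence of \<open>p\<close>, so the total error remains a multiple
    of the original \<open>p\<close>.\<close>
  also have "b = e \<oplus> p \<otimes> p \<otimes> z \<otimes> r"
    using e(4) q by simp
  finally have "a = e \<oplus> p \<otimes> (s \<oplus> p \<otimes> z \<otimes> r)"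
    using e(1,2) by (simp add: r_distr m_assoc a_ac)
  then show ?case
    using e(1-3) unfolding p_def[symmetric]
    by (intro bexI[of _ e] bexI[of _ "s \<oplus> p \<otimes> z \<otimes> r"] conjI) simp_all
qed

section \<open>The nilpotency criterion and its transfer\<close>

lemma (in ring) ring_nilpotent_mult:
  assumes "ring_nilpotent R x" "y \<in> carrier R" "x \<otimes> y = y \<otimes> x"
  shows "ring_nilpotent R (x \<otimes> y)"
proof -
  obtain k :: nat where "x \<in> carrier R" "k \<ge> 1" "x [^] k = \<zero>"
    using assms(1) by (auto simp: ring_nilpotent_def)
  moreover from this have "(x \<otimes> y) [^] k = \<zero>"
    using assms(2,3) pow_mult_distrib[of x y k] by simp
  ultimately show ?thesis
    using assms(2) by (auto simp: ring_nilpotent_def)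
qed

text \<open>The additive form \<open>a = a \<otimes> a \<oplus> p\<close> determines
  \<open>p\<close> and lets homomorphisms act on sums and products only.\<close>

lemma (in ring) strongly_nil_clean_iff:
  "strongly_nil_clean R a \<longleftrightarrow>
     a \<in> carrier R \<and> (\<exists>p. ring_nilpotent R p \<and> a = a \<otimes> a \<oplus> p)"
proof
  assume "strongly_nil_clean R a"
  then obtain e t where et: "e \<in> carrier R" "e \<otimes> e = e" "ring_nilpotent R t"
      "a = e \<oplus> t" "e \<otimes> t = t \<otimes> e"
    by (auto simp: strongly_nil_clean_def ring_idempotent_def)
  then have t: "t \<in> carrier R" by (simp add: ring_nilpotent_def)
  define C where "C = bicommutant R {e, t}"
  have C: "e \<in> C" "t \<in> C" "C \<subseteq> carrier R"
    using et t subset_bicommutant[of "{e, t}" R] by (auto simp: C_def bicommutant_def)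
  interpret C: cring "R \<lparr>carrier := C\<rparr>"
    unfolding C_def using et t by (intro cring_bicommutant) auto
  \<comment> \<open>As \<open>e\<close> and \<open>t\<close> commute, (e + t)^2 = e + tw, which
    leaves a - a^2 = t(1 - w).\<close>
  define w where "w = e \<oplus> e \<oplus> t"
  define s where "s = \<one> \<ominus> w"
  have w: "w \<in> carrier R" using et t by (simp add: w_def)
  have s: "s \<in> C"
    using subringE[OF subring_bicommutant[of "{e, t}"]] C
    by (simp add: s_def w_def minus_eq C_def)
  have "w \<oplus> s = \<one>"
    using w eq_add_iff_eq_minus[of \<one> w s] by (simp add: s_def)
  then have "t = t \<otimes> w \<oplus> t \<otimes> s"
    using t w r_distr[of w s t] by (simp add: s_def)
  also have "t \<otimes> w = (e \<oplus> e) \<otimes> t \<oplus> t \<otimes> t"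
    using et t by (simp add: w_def l_distr r_distr)
  finally have "e \<oplus> t = (e \<otimes> e \<oplus> (e \<oplus> e) \<otimes> t \<oplus> t \<otimes> t) \<oplus> t \<otimes> s"
    using et t w by (simp add: a_assoc s_def)
  also have "e \<otimes> e \<oplus> (e \<oplus> e) \<otimes> t \<oplus> t \<otimes> t = a \<otimes> a"
    using et t by (simp add: l_distr r_distr a_ac)
  finally have "a = a \<otimes> a \<oplus> t \<otimes> s"
    using et by simp
  moreover have "ring_nilpotent R (t \<otimes> s)"
    using C s C.m_comm[of t s] et by (intro ring_nilpotent_mult) auto
  ultimately show "a \<in> carrier R \<and> (\<exists>p. ring_nilpotent R p \<and> a = a \<otimes> a \<oplus> p)"
    using et t by auto
next
  assume "a \<in> carrier R \<and> (\<exists>p. ring_nilpotent R p \<and> a = a \<otimes> a \<oplus> p)"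
  then obtain p and k :: nat where p: "a \<in> carrier R" "p \<in> carrier R" "a = a \<otimes> a \<oplus> p"
      "k \<ge> 1" "p [^] k = \<zero>" "ring_nilpotent R p"
    by (auto simp: ring_nilpotent_def)
  define c where "c = \<one> \<ominus> a"
  have c: "c \<in> carrier R" "a \<oplus> c = \<one>"
    using p(1) eq_add_iff_eq_minus[of \<one> a c] by (simp_all add: c_def)
  then have "a = a \<otimes> a \<oplus> a \<otimes> c"
    using p(1) r_distr[of a c a] by simp
  then have pc: "p = a \<otimes> c"
    using p(1-3) c eq_add_iff_eq_minus[of a "a \<otimes> a"] by simp
  define C where "C = bicommutant R {a}"
  have "subring C R" unfolding C_def by (rule subring_bicommutant)
  then have C: "a \<in> C" "c \<in> C" "p \<in> C" "C \<subseteq> carrier R"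
    using p(1) subset_bicommutant[of "{a}" R] subringE[of C R]
    by (auto simp: C_def minus_eq c_def pc)
  interpret C: cring "R \<lparr>carrier := C\<rparr>"
    unfolding C_def using p by (intro cring_bicommutant) auto
  \<comment> \<open>\<open>Suc (k - 1)\<close> is \<open>k\<close> because \<open>k \<ge> 1\<close>;
    this is the shape of exponent that \<open>lift_idempotent\<close> expects.\<close>
  have "p [^]\<^bsub>R \<lparr>carrier := C\<rparr>\<^esub> Suc (k - 1) = \<zero>"
    using p(4,5) nat_pow_consistent[of p k C] by simp
  \<comment> \<open>Lifting inside \<open>C\<close> keeps \<open>e\<close> and \<open>r\<close> in a
    commutative ring, so \<open>e\<close> commutes with the nilpotent part
    \<open>p \<otimes> r\<close>.\<close>
  then obtain e r where er: "e \<in> C" "r \<in> C" "e \<otimes> e = e" "a = e \<oplus> p \<otimes> r"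
    using C.lift_idempotent[of a c "k - 1"] C c(2) pc by auto
  have "ring_nilpotent R (p \<otimes> r)"
    using C er p C.m_comm[of p r] by (intro ring_nilpotent_mult) auto
  moreover have "e \<otimes> (p \<otimes> r) = (p \<otimes> r) \<otimes> e"
    using C er C.m_comm[of e "p \<otimes> r"] C.m_closed[of p r] by auto
  ultimately show "strongly_nil_clean R a"
    using C er unfolding strongly_nil_clean_def ring_idempotent_def by blast
qed

text \<open>No idempotent has to be lifted along \<open>h\<close>: the only possible error term for
  \<open>h a\<close> is the image of a - a^2, and \<open>h\<close> both preserves and reflects
  nilpotency.\<close>

lemma (in ring_hom_ring) strongly_nil_clean_hom_iff:
  assumes ker: "\<And>x. x \<in> carrier R \<Longrightarrow> h x = \<zero>\<^bsub>S\<^esub> \<Longrightarrow> ring_nilpotent R x"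
    and a: "a \<in> carrier R"
  shows "strongly_nil_clean R a \<longleftrightarrow> strongly_nil_clean S (h a)"
proof -
  have pow: "h (x [^] k) = h x [^]\<^bsub>S\<^esub> k" if "x \<in> carrier R" for x and k :: nat
    using that by (induction k) simp_all
  have nil: "ring_nilpotent R x \<longleftrightarrow> ring_nilpotent S (h x)" if x: "x \<in> carrier R" for x
  proof
    assume "ring_nilpotent R x"
    then show "ring_nilpotent S (h x)"
      using x by (auto simp: ring_nilpotent_def simp flip: pow)
  next
    assume "ring_nilpotent S (h x)"
    then obtain k :: nat where k: "k \<ge> 1" "h (x [^] k) = \<zero>\<^bsub>S\<^esub>"
      using x by (auto simp: ring_nilpotent_def pow)
    \<comment> \<open>\<open>x [^] k\<close> lies in the kernel, so it is nilpotent; the two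
      exponents multiply.\<close>
    then obtain l :: nat where l: "l \<ge> 1" "(x [^] k) [^] l = \<zero>"
      using ker[of "x [^] k"] x by (auto simp: ring_nilpotent_def)
    then have "x [^] (k * l) = \<zero>" "k * l \<ge> 1"
      using x k by (simp_all add: R.nat_pow_pow)
    with x show "ring_nilpotent R x"
      unfolding ring_nilpotent_def by blast
  qed
  show ?thesis
  proof
    assume "strongly_nil_clean R a"
    then obtain p where p: "ring_nilpotent R p" "a = a \<otimes> a \<oplus> p"
      unfolding R.strongly_nil_clean_iff by blast
    then have "p \<in> carrier R" by (simp add: ring_nilpotent_def)
    moreover from this have "h a = h a \<otimes>\<^bsub>S\<^esub> h a \<oplus>\<^bsub>S\<^esub> h p"
      using p(2) a by (metis R.m_closed hom_add hom_mult)
    ultimately show "strongly_nil_clean S (h a)"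
      unfolding S.strongly_nil_clean_iff using a p(1) nil by auto
  next
    assume "strongly_nil_clean S (h a)"
    then obtain q where q: "ring_nilpotent S q" "h a = h a \<otimes>\<^bsub>S\<^esub> h a \<oplus>\<^bsub>S\<^esub> q"
      unfolding S.strongly_nil_clean_iff by blast
    then have qc: "q \<in> carrier S" by (simp add: ring_nilpotent_def)
    define p where "p = a \<ominus> a \<otimes> a"
    have p: "p \<in> carrier R" using a by (simp add: p_def)
    have ap: "a = a \<otimes> a \<oplus> p"
      using a p R.eq_add_iff_eq_minus[of a "a \<otimes> a" p] p_def by simp
    then have "h a = h a \<otimes>\<^bsub>S\<^esub> h a \<oplus>\<^bsub>S\<^esub> h p"
      using p a by (metis R.m_closed hom_add hom_mult)
    then have "h p = q"
      using q(2) qc p a S.eq_add_iff_eq_minus[of "h a" "h a \<otimes>\<^bsub>S\<^esub> h a"] by simp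
    with q(1) p nil have "ring_nilpotent R p" by simp
    with a ap show "strongly_nil_clean R a"
      unfolding R.strongly_nil_clean_iff by blast
  qed
qed

section \<open>The standard part of dual matrices\<close>

lemma semiring_hom_std_part: "semiring_hom std_part"
  by unfold_locales
    (simp_all add: zero_dual_number_def one_dual_number_def plus_dual_number_def times_dual_number_def)

lemma ring_hom_ring_std_part:
  "ring_hom_ring (ring_mat TYPE(dual_number) n ()) (ring_mat TYPE(real) n ()) (map_mat std_part)"
proof -
  interpret semiring_hom std_part by (rule semiring_hom_std_part)
  show ?thesis
    by (intro ring_hom_ringI ring_mat)
      (auto simp: ring_mat_simps mat_hom_mult mat_hom_one hom_add intro!: eq_matI)
qed

lemma map_mat_std_part_dual_mat:
  assumes "A \<in> carrier_mat n n" "B \<in> carrier_mat n n"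
  shows "map_mat std_part (dual_mat A B) = A"
  using assms by (auto intro!: eq_matI simp: dual_mat_def of_real_dual_number dual_eps_def
      plus_dual_number_def times_dual_number_def)

text \<open>Every entry of \<open>X\<close> is a multiple of eps, so each summand in an entry of the
  product carries eps^2 = 0.\<close>

lemma infinitesimal_mat_square_zero:
  assumes X: "X \<in> carrier_mat n n" and 0: "map_mat std_part X = 0\<^sub>m n n"
  shows "X * X = 0\<^sub>m n n"
proof -
  have std: "std_part (X $$ (i, j)) = 0" if "i < n" "j < n" for i j
    using arg_cong[OF 0, of "\<lambda>M. M $$ (i, j)"] that X by simp
  have "X $$ (i, l) * X $$ (l, j) = 0" if "i < n" "l < n" "j < n" for i j l
    using std that by (simp add: times_dual_number_def zero_dual_number_def)
  then show ?thesis
    using X by (auto intro!: eq_matI sum.neutral simp: scalar_prod_def)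
qed

theorem theorem4p6:
  fixes n :: nat and A B :: "real mat"
  assumes "n \<ge> 1"
    and "A \<in> carrier_mat n n"
    and "B \<in> carrier_mat n n"
  shows "strongly_nil_clean (ring_mat TYPE(dual_number) n ()) (dual_mat A B) \<longleftrightarrow>
         strongly_nil_clean (ring_mat TYPE(real) n ()) A"
proof -
  interpret ring_hom_ring "ring_mat TYPE(dual_number) n ()" "ring_mat TYPE(real) n ()"
      "map_mat std_part"
    by (rule ring_hom_ring_std_part)
  have "ring_nilpotent (ring_mat TYPE(dual_number) n ()) X"
    if "X \<in> carrier_mat n n" "map_mat std_part X = 0\<^sub>m n n" for X
    using that infinitesimal_mat_square_zero[OF that]
    by (auto simp: ring_nilpotent_def ring_mat_simps numeral_2_eq_2 intro!: exI[of _ 2])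
  moreover have "dual_mat A B \<in> carrier_mat n n"
    using assms by (auto simp: dual_mat_def)
  ultimately show ?thesis
    using strongly_nil_clean_hom_iff[of "dual_mat A B"] map_mat_std_part_dual_mat[OF assms(2,3)]
    by (simp add: ring_mat_simps)
qed

end
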